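(* Let $d>1$. Suppose the prior $\pi_{\bm w}$ of the learner-optimal parameter $\bm w_\ell^*(D)\in\mathbb R^d$ is non-degenerate, has finite first moment, and is spherically symmetric around its mean $\bar{\bm w}:=\mathbb E_{\pi_{\bm w}}[\bm w_\ell^*(D)]$. Then learning is influential for every bias vector $\bm b\in\mathbb R^d$.
   Context: Game. A user holds a private dataset $D$; the only payoff-relevant information in it is the learner-optimal parameter $\bm w_\ell^*(D)\in\mathbb R^d$, which is distributed according to a commonly known prior $\pi_{\bm w}$. The user observes $\bm w_\ell^*(D)$ and sends a report $M$ from a report space $\mathcal M$ (reports are costless and unverifiable; $\mathcal M$ is rich enough to name any measurable region of the parameter space). The learner observes only $M$ and chooses a deployed parameter $\bm w\in\mathbb R^d$. Utilities are $$U^\ell(D,\bm w)=-\|\bm w-\bm w_\ell^*(D)\|_2^2,\qquad U^r(D,\bm w)=-\|\bm w-(\bm w_\ell^*(D)+\bm b)\|_2^2$$ for the learner and the user respectively. Strategies. A user strategy $\sigma_r(\cdot\mid \bm x)$ assigns to each value $\bm x$ of $\bm w_\ell^*(D)$ a probability distribution on $\mathcal M$; a learner strategy $\sigma_\ell(\cdot\mid M)$ assigns to each report a probability distribution on $\mathbb R^d$. The learner's belief $\Phi(\cdot\mid M)$ is the conditional distribution of $\bm w_\ell^*(D)$ given $M$ obtained by Bayes' rule from $\pi_{\bm w}$ and $\sigma_r$ (for reports that are not sent under $\sigma_r$, any belief is allowed). Maximizing the learner's expected quadratic utility means responding with the posterior mean. Equilibrium. $(\sigma_r,\sigma_\ell)$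 (with such beliefs) is an equilibrium if every report used at a value of $\bm w_\ell^*(D)$ maximizes the user's expected utility $M'\mapsto \mathbb E_{\bm w\sim\sigma_\ell(\cdot\mid M')}[U^r(D,\bm w)]$ over $\mathcal M$, and every parameter used by the learner after $M$ maximizes the learner's expected utility $\bm w'\mapsto\mathbb E_{D\sim\Phi(\cdot\mid M)}[U^\ell(D,\bm w')]$. Influence. An equilibrium is influential if there are two distinct reports $M,M'$, both sent with positive probability under $(\sigma_r,\pi_{\bm w})$, with $\sigma_\ell(\cdot\mid M)\neq\sigma_\ell(\cdot\mid M')$. "Learning is influential" means that at least one influential equilibrium exists. Spherically symmetric around $\bar{\bm w}$ means that the law of $\bm w_\ell^*(D)-\bar{\bm w}$ is invariant under all orthogonal transformations; non-degenerate means not a point mass. *)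

theory Defs
  imports "HOL-Probability.Probability"
begin

text \<open>
  The private dataset enters the game only through the learner-optimal parameter, which is
  written \<open>x\<close> below; the prior, the strategies and the beliefs refer to this parameter.
\<close>

definition learner_utility :: "real ^ 'n \<Rightarrow> real ^ 'n \<Rightarrow> real" where
  "learner_utility x w = - (norm (w - x))\<^sup>2"

definition user_utility :: "real ^ 'n \<Rightarrow> real ^ 'n \<Rightarrow> real ^ 'n \<Rightarrow> real" where
  "user_utility b x w = - (norm (w - (x + b)))\<^sup>2"

text \<open>
  Expectation of a nonpositive utility, with values in \<open>[-\<infinity>, 0]\<close>. The Bochner integral is not
  used here because it assigns the value 0, the best possible one, to a utility that is not
  integrable.
\<close>

definition expected_utility :: "'a measure \<Rightarrow> ('a \<Rightarrow> real) \<Rightarrow> ereal" where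
  "expected_utility P u = - enn2ereal (\<integral>\<^sup>+ z. ennreal (- u z) \<partial>P)"

definition spherically_symmetric_around :: "(real ^ 'n) measure \<Rightarrow> real ^ 'n \<Rightarrow> bool" where
  "spherically_symmetric_around P c \<longleftrightarrow>
     (\<forall>T. orthogonal_transformation T \<longrightarrow>
        distr P borel (\<lambda>x. T (x - c)) = distr P borel (\<lambda>x. x - c))"

text \<open>
  A report space for parameters in \<open>real ^ 'n\<close>: every measurable region has a report of its own.
  Measurability of singletons gives a meaning to the probability that a given report is sent.
\<close>

definition rich_report_space :: "'n::finite itself \<Rightarrow> 'm measure \<Rightarrow> bool" where
  "rich_report_space _ R \<longleftrightarrow>
     (\<forall>m\<in>space R. {m} \<in> sets R) \<and>
     (\<exists>name :: (real ^ 'n) set \<Rightarrow> 'm.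
        inj_on name (sets borel) \<and> name ` sets borel \<subseteq> space R)"

definition user_strategy :: "'m measure \<Rightarrow> (real ^ 'n \<Rightarrow> 'm measure) \<Rightarrow> bool" where
  "user_strategy R \<sigma>r \<longleftrightarrow> \<sigma>r \<in> borel \<rightarrow>\<^sub>M prob_algebra R"

definition learner_strategy :: "'m measure \<Rightarrow> ('m \<Rightarrow> (real ^ 'n) measure) \<Rightarrow> bool" where
  "learner_strategy R \<sigma>l \<longleftrightarrow> \<sigma>l \<in> R \<rightarrow>\<^sub>M prob_algebra borel"

definition report_law :: "(real ^ 'n) measure \<Rightarrow> (real ^ 'n \<Rightarrow> 'm measure) \<Rightarrow> 'm measure" where
  "report_law P \<sigma>r = P \<bind> \<sigma>r"

text \<open>
  Bayes' rule: \<open>\<Phi>\<close> is a regular conditional distribution of the parameter given the report, i.e.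
  both sides below are the joint probability that the parameter is in \<open>A\<close> and the report in \<open>B\<close>.
  This does not restrict \<open>\<Phi>\<close> on sets of reports that are sent with probability zero.
\<close>

definition bayes_belief ::
  "'m measure \<Rightarrow> (real ^ 'n) measure \<Rightarrow> (real ^ 'n \<Rightarrow> 'm measure) \<Rightarrow> ('m \<Rightarrow> (real ^ 'n) measure) \<Rightarrow> bool"
where
  "bayes_belief R P \<sigma>r \<Phi> \<longleftrightarrow>
     \<Phi> \<in> R \<rightarrow>\<^sub>M prob_algebra borel \<and>
     (\<forall>A\<in>sets borel. \<forall>B\<in>sets R.
        (\<integral>\<^sup>+ x\<in>A. emeasure (\<sigma>r x) B \<partial>P) = (\<integral>\<^sup>+ m\<in>B. emeasure (\<Phi> m) A \<partial>report_law P \<sigma>r))"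

definition user_best_report ::
  "'m measure \<Rightarrow> real ^ 'n \<Rightarrow> ('m \<Rightarrow> (real ^ 'n) measure) \<Rightarrow> real ^ 'n \<Rightarrow> 'm \<Rightarrow> bool"
where
  "user_best_report R b \<sigma>l x m \<longleftrightarrow>
     (\<forall>m'\<in>space R. expected_utility (\<sigma>l m') (user_utility b x)
                    \<le> expected_utility (\<sigma>l m) (user_utility b x))"

text \<open>
  If the belief \<open>Q\<close> has a finite second moment, the last conjunct alone singles out the mean of
  \<open>Q\<close>. Only first moments are assumed finite, however: if the second moment is infinite, the
  expected utility of every parameter is \<open>-\<infinity>\<close>, and the response is then by convention still
  the posterior mean.
\<close>

definition learner_best_response :: "(real ^ 'n) measure \<Rightarrow> real ^ 'n \<Rightarrow> bool" where
  "learner_best_response Q w \<longleftrightarrow>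
     integrable Q (\<lambda>x. x) \<and> w = (\<integral>x. x \<partial>Q) \<and>
     (\<forall>w'. expected_utility Q (\<lambda>x. learner_utility x w')
            \<le> expected_utility Q (\<lambda>x. learner_utility x w))"

text \<open>
  ``Every report (parameter) used'' is read as ``almost every one under the mixed strategy'', at
  every value of the parameter and after every report, sent or not.
\<close>

definition equilibrium ::
  "'m measure \<Rightarrow> (real ^ 'n) measure \<Rightarrow> real ^ 'n \<Rightarrow>
   (real ^ 'n \<Rightarrow> 'm measure) \<Rightarrow> ('m \<Rightarrow> (real ^ 'n) measure) \<Rightarrow> bool"
where
  "equilibrium R P b \<sigma>r \<sigma>l \<longleftrightarrow>
     user_strategy R \<sigma>r \<and> learner_strategy R \<sigma>l \<and>
     (\<forall>x. AE m in \<sigma>r x. user_best_report R b \<sigma>l x m) \<and>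
     (\<exists>\<Phi>. bayes_belief R P \<sigma>r \<Phi> \<and>
        (\<forall>m\<in>space R. AE w in \<sigma>l m. learner_best_response (\<Phi> m) w))"

definition influential ::
  "'m measure \<Rightarrow> (real ^ 'n) measure \<Rightarrow>
   (real ^ 'n \<Rightarrow> 'm measure) \<Rightarrow> ('m \<Rightarrow> (real ^ 'n) measure) \<Rightarrow> bool"
where
  "influential R P \<sigma>r \<sigma>l \<longleftrightarrow>
     (\<exists>m\<in>space R. \<exists>m'\<in>space R. m \<noteq> m' \<and>
        measure (report_law P \<sigma>r) {m} > 0 \<and> measure (report_law P \<sigma>r) {m'} > 0 \<and>
        \<sigma>l m \<noteq> \<sigma>l m')"

definition learning_is_influential ::
  "'m measure \<Rightarrow> (real ^ 'n) measure \<Rightarrow> real ^ 'n \<Rightarrow> bool"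
where
  "learning_is_influential R P b \<longleftrightarrow>
     (\<exists>\<sigma>r \<sigma>l. equilibrium R P b \<sigma>r \<sigma>l \<and> influential R P \<sigma>r \<sigma>l)"

end

theory Submission
  imports Defs
begin

text \<open>
  Choose a unit vector \<open>u\<close> orthogonal to the bias \<open>b\<close> and let the user report on which side of the
  hyperplane through the mean \<open>c\<close> orthogonal to \<open>u\<close> the parameter lies, tossing a fair coin on the
  hyperplane itself (which has positive mass if the prior has an atom at \<open>c\<close>). By symmetry the two
  posterior means are \<open>c + t u\<close> and \<open>c - t u\<close> with \<open>t = E \<bar>u \<bullet> (x - c)\<bar> > 0\<close>. Their
  perpendicular bisector is the same hyperplane, and a shift by \<open>b\<close> does not cross it, so that the
  biased user is truthful. Reports that are never sent are treated as one of the two.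
\<close>

section \<open>Quadratic loss and the posterior mean\<close>

lemma expected_utility_le_iff:
  "expected_utility P u \<le> expected_utility P' u' \<longleftrightarrow>
     (\<integral>\<^sup>+ z. ennreal (- u' z) \<partial>P') \<le> (\<integral>\<^sup>+ z. ennreal (- u z) \<partial>P)"
  unfolding expected_utility_def by (simp add: less_eq_ennreal.rep_eq)

text \<open>The losses at \<open>w\<close> and \<open>w'\<close> differ by an affine function of
  \<open>x\<close>, so a finite expected loss at \<open>w'\<close> and a finite first moment give a
  finite expected loss at \<open>w\<close>; integrated, the gap is
  \<open>(norm (w - w'))\<^sup>2\<close>. An infinite loss at \<open>w'\<close> leaves nothing to
  show.\<close>

lemma learner_best_response_mean:
  fixes Q :: "(real ^ 'n) measure"
  assumes "prob_space Q" and sets[measurable_cong]: "sets Q = sets borel"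
    and int: "integrable Q (\<lambda>x. x)"
  shows "learner_best_response Q (\<integral>x. x \<partial>Q)"
proof -
  interpret prob_space Q by fact
  define w where "w = (\<integral>x. x \<partial>Q)"
  have "(\<integral>\<^sup>+x. ennreal ((norm (w - x))\<^sup>2) \<partial>Q) \<le> (\<integral>\<^sup>+x. ennreal ((norm (w' - x))\<^sup>2) \<partial>Q)" for w'
  proof (cases "(\<integral>\<^sup>+x. ennreal ((norm (w' - x))\<^sup>2) \<partial>Q) = \<infinity>")
    case False
    then have i': "integrable Q (\<lambda>x. (norm (w' - x))\<^sup>2)"
      by (intro integrableI_nonneg) (auto simp: less_top[symmetric])
    have eq: "(norm (w - x))\<^sup>2 = (norm (w' - x))\<^sup>2 + (2 * ((w' - w) \<bullet> x) + (norm w)\<^sup>2 - (norm w')\<^sup>2)" for x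
      unfolding power2_norm_eq_inner by (simp add: inner_diff inner_commute algebra_simps)
    have iw: "integrable Q (\<lambda>x. (w' - w) \<bullet> x)" by (intro integrable_inner_right int)
    have i: "integrable Q (\<lambda>x. (norm (w - x))\<^sup>2)"
      unfolding eq using i' iw by (intro Bochner_Integration.integrable_add
         Bochner_Integration.integrable_diff integrable_mult_right) auto
    have "(\<integral>x. (norm (w - x))\<^sup>2 \<partial>Q)
        = (\<integral>x. (norm (w' - x))\<^sup>2 \<partial>Q) + (2 * ((w' - w) \<bullet> w) + (norm w)\<^sup>2 - (norm w')\<^sup>2)"
      unfolding eq using i' iw int by (simp add: prob_space w_def)
    also have "\<dots> = (\<integral>x. (norm (w' - x))\<^sup>2 \<partial>Q) - (norm (w - w'))\<^sup>2"
      unfolding power2_norm_eq_inner by (simp add: inner_diff inner_commute algebra_simps)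
    finally have "(\<integral>x. (norm (w - x))\<^sup>2 \<partial>Q) \<le> (\<integral>x. (norm (w' - x))\<^sup>2 \<partial>Q)" by simp
    then show ?thesis
      using i i' by (simp add: nn_integral_eq_integral ennreal_leI)
  qed simp
  then show ?thesis
    using int by (simp add: learner_best_response_def expected_utility_le_iff learner_utility_def w_def)
qed

section \<open>Orthogonal invariance of integrals, and point masses\<close>

lemma integral_symmetric:
  fixes h :: "real ^ 'n \<Rightarrow> 'b :: {banach, second_countable_topology}"
  assumes "spherically_symmetric_around P c" and [measurable_cong]: "sets P = sets borel"
    and T: "orthogonal_transformation T" and [measurable]: "h \<in> borel_measurable borel"
  shows "(\<integral>x. h (T (x - c)) \<partial>P) = (\<integral>x. h (x - c) \<partial>P)"
proof -
  have [measurable]: "T \<in> borel_measurable borel"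
    using T by (intro borel_measurable_continuous_onI linear_continuous_on)
      (auto dest: orthogonal_transformation_linear simp: linear_conv_bounded_linear)
  have "(\<integral>x. h (T (x - c)) \<partial>P) = (\<integral>y. h y \<partial>distr P borel (\<lambda>x. T (x - c)))"
    by (subst integral_distr) auto
  also have "\<dots> = (\<integral>y. h y \<partial>distr P borel (\<lambda>x. x - c))"
    using assms(1) T by (simp add: spherically_symmetric_around_def)
  also have "\<dots> = (\<integral>x. h (x - c) \<partial>P)"
    by (subst integral_distr) auto
  finally show ?thesis .
qed

lemma prob_space_eq_return:
  assumes "prob_space P" and "sets P = sets borel" and ae: "AE x in P. x = c"
  shows "P = return borel (c :: 'a :: topological_space)"
proof (rule measure_eqI)
  fix A assume A: "A \<in> sets P"
  interpret prob_space P by fact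
  have "emeasure P A = (\<integral>\<^sup>+x. indicator A x \<partial>P)" using A by simp
  also have "\<dots> = (\<integral>\<^sup>+x. indicator A c \<partial>P)" using ae by (intro nn_integral_cong_AE) auto
  also have "\<dots> = indicator A c" by (simp add: emeasure_space_1)
  finally show "emeasure P A = emeasure (return borel c) A" using A assms(2) by simp
qed (use assms in auto)

section \<open>Posteriors after learning the side of the hyperplane\<close>

locale split_prior = prob_space \<pi> for \<pi> :: "(real ^ 'n) measure" +
  fixes c u :: "real ^ 'n"
  assumes sets_prior[measurable_cong]: "sets \<pi> = sets borel"
    and integrable_norm_prior: "integrable \<pi> (\<lambda>x. norm x)"
    and not_return: "\<pi> \<noteq> return borel c"
    and sym: "spherically_symmetric_around \<pi> c"
    and mean: "c = (\<integral>x. x \<partial>\<pi>)"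
    and norm_u: "norm u = 1"
begin

text \<open>The value 0 on the hyperplane encodes the fair coin: \<open>(1 + side x) / 2\<close> is
  the probability of the first report, equal to 1, 1/2 or 0.\<close>

definition side :: "real ^ 'n \<Rightarrow> real" where
  "side x = sgn (u \<bullet> (x - c))"

definition t :: real where
  "t = (\<integral>x. \<bar>u \<bullet> (x - c)\<bar> \<partial>\<pi>)"

text \<open>For \<open>s = 1\<close> and \<open>s = - 1\<close> these are the two posteriors: the
  likelihood \<open>(1 + s * side x) / 2\<close> of a report divided by its total probability
  1/2.\<close>

definition tilt :: "real \<Rightarrow> (real ^ 'n) measure" where
  "tilt s = density \<pi> (\<lambda>x. ennreal (1 + s * side x))"

lemma side_measurable[measurable]: "side \<in> borel_measurable borel"
  unfolding side_def sgn_real_def by measurable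

lemma abs_side_le: "\<bar>side x\<bar> \<le> 1"
  by (simp add: side_def sgn_real_def)

lemma integrable_prior: "integrable \<pi> (\<lambda>x. x)"
  using integrable_norm_prior by (simp add: integrable_norm_iff)

lemma integrable_side: "integrable \<pi> side"
  by (rule integrable_const_bound[of _ 1]) (auto simp: abs_side_le)

lemma integrable_side_scaleR: "integrable \<pi> (\<lambda>x. side x *\<^sub>R x)"
  by (rule Bochner_Integration.integrable_bound[OF integrable_prior])
     (auto simp: abs_side_le mult_left_le_one_le)

text \<open>Point reflection through \<open>c\<close> preserves the prior and changes the sign of
  \<open>side\<close>. This is why both reports have probability 1/2.\<close>

lemma integral_side: "(\<integral>x. side x \<partial>\<pi>) = 0"
proof -
  have "(\<integral>x. sgn (u \<bullet> - (x - c)) \<partial>\<pi>) = (\<integral>x. side x \<partial>\<pi>)"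
    unfolding side_def
    by (rule integral_symmetric[OF sym sets_prior]) (auto simp: orthogonal_transformation_neg)
  then show ?thesis
    unfolding inner_minus_right sgn_minus by (simp flip: side_def)
qed

lemma one_plus_side_nonneg: "\<bar>s\<bar> \<le> 1 \<Longrightarrow> 0 \<le> 1 + s * side x"
  using mult_mono[of "\<bar>s\<bar>" 1 "\<bar>side x\<bar>" 1] abs_side_le[of x] by (simp flip: abs_mult)

lemma integral_one_plus_side: "(\<integral>\<^sup>+x. ennreal (1 + s * side x) \<partial>\<pi>) = 1" if "\<bar>s\<bar> \<le> 1"
  using that integrable_side
  by (subst nn_integral_eq_integral) (auto simp: one_plus_side_nonneg integral_side prob_space)

lemma prob_space_tilt: "\<bar>s\<bar> \<le> 1 \<Longrightarrow> prob_space (tilt s)"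
  by (intro prob_spaceI)
    (simp add: tilt_def emeasure_density integral_one_plus_side)

lemma sets_tilt[measurable_cong]: "sets (tilt s) = sets borel"
  by (simp add: tilt_def sets_prior)

lemma tilt_in_prob_algebra: "\<bar>s\<bar> \<le> 1 \<Longrightarrow> tilt s \<in> space (prob_algebra borel)"
  by (simp add: space_prob_algebra sets_tilt prob_space_tilt)

text \<open>The half-turn about the line spanned by \<open>u\<close> preserves \<open>u \<bullet> y\<close> and so fixes this mean.\<close>

lemma integral_side_scaleR: "(\<integral>x. side x *\<^sub>R x \<partial>\<pi>) = t *\<^sub>R u"
proof -
  define T where "T y = (2 * (u \<bullet> y)) *\<^sub>R u - y" for y
  have uu: "u \<bullet> u = 1" using norm_u by (simp add: norm_eq_1)
  have uT: "u \<bullet> T y = u \<bullet> y" for y by (simp add: T_def inner_diff uu)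
  have lin: "linear T"
    unfolding T_def by (intro linearI) (auto simp: inner_add algebra_simps)
  have "T v \<bullet> T w = v \<bullet> w" for v w
    by (simp add: T_def inner_diff inner_commute uu algebra_simps)
  with lin have T: "orthogonal_transformation T" by (simp add: orthogonal_transformation_def)
  let ?k = "\<integral>x. side x *\<^sub>R (x - c) \<partial>\<pi>"
  have ik: "integrable \<pi> (\<lambda>x. side x *\<^sub>R (x - c))"
    using integrable_side_scaleR integrable_side by (simp add: scaleR_diff_right)
  have "?k = (\<integral>x. sgn (u \<bullet> T (x - c)) *\<^sub>R T (x - c) \<partial>\<pi>)"
    using integral_symmetric[OF sym sets_prior T, of "\<lambda>y. sgn (u \<bullet> y) *\<^sub>R y"]
    by (simp add: side_def)
  also have "\<dots> = (\<integral>x. T (side x *\<^sub>R (x - c)) \<partial>\<pi>)"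
    by (simp add: uT side_def linear_scale[OF lin])
  also have "\<dots> = T ?k"
    using integral_bounded_linear[OF _ ik, of T] lin by (simp add: linear_conv_bounded_linear)
  finally have "2 *\<^sub>R ?k = 2 *\<^sub>R (u \<bullet> ?k) *\<^sub>R u"
    unfolding T_def by (simp add: scaleR_2 algebra_simps)
  then have "?k = (u \<bullet> ?k) *\<^sub>R u"
    unfolding real_vector.scale_cancel_left by simp
  also have "u \<bullet> ?k = (\<integral>x. u \<bullet> (side x *\<^sub>R (x - c)) \<partial>\<pi>)"
    by (rule integral_inner_right[symmetric]) (rule ik)
  also have "\<dots> = t"
    unfolding t_def side_def by (simp add: abs_sgn mult.commute)
  finally have k: "?k = t *\<^sub>R u" .
  \<comment> \<open>Centring at \<open>c\<close> was needed for the symmetry argument; it changes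
    nothing in the integral because \<open>side\<close> has mean zero.\<close>
  have "?k = (\<integral>x. side x *\<^sub>R x \<partial>\<pi>) - (\<integral>x. side x *\<^sub>R c \<partial>\<pi>)"
    unfolding scaleR_diff_right using integrable_side_scaleR integrable_side by simp
  then show ?thesis using k integrable_side by (simp add: integral_side)
qed

text \<open>Under the density \<open>1 + s * side x\<close> the mean is the prior mean
  \<open>c\<close> plus \<open>s\<close> times the signed moment
  \<open>t *\<^sub>R u\<close>.\<close>

lemma learner_best_response_tilt:
  assumes s: "\<bar>s\<bar> \<le> 1"
  shows "learner_best_response (tilt s) (c + (s * t) *\<^sub>R u)"
proof -
  have i: "integrable \<pi> (\<lambda>x. (1 + s * side x) *\<^sub>R x)"
    using integrable_prior integrable_side_scaleR
    by (simp add: scaleR_add_left flip: scaleR_scaleR)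
  have "integrable (tilt s) (\<lambda>x. x)"
    unfolding tilt_def using i s by (subst integrable_density) (auto simp: one_plus_side_nonneg)
  moreover have "(\<integral>x. x \<partial>tilt s) = (\<integral>x. (1 + s * side x) *\<^sub>R x \<partial>\<pi>)"
    unfolding tilt_def using s by (subst integral_density) (auto simp: one_plus_side_nonneg)
  moreover have "\<dots> = c + (s * t) *\<^sub>R u"
    using integrable_prior integrable_side_scaleR
    by (simp add: scaleR_add_left integral_side_scaleR mean[symmetric] flip: scaleR_scaleR)
  ultimately show ?thesis
    using learner_best_response_mean[OF prob_space_tilt[OF s] sets_tilt] by simp
qed

text \<open>If \<open>t\<close> vanished, symmetry would make the first absolute moment about
  \<open>c\<close> vanish along every coordinate axis, and the prior would be a point mass at
  \<open>c\<close>.\<close>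

lemma t_pos: "t > 0"
proof (rule ccontr)
  assume "\<not> t > 0"
  moreover have "t \<ge> 0" unfolding t_def by simp
  ultimately have t0: "t = 0" by simp
  have "AE x in \<pi>. x $ i = c $ i" for i
  proof -
    \<comment> \<open>Orthogonal maps act transitively on the unit sphere, so the direction
      \<open>u\<close> can be exchanged for any axis.\<close>
    have "norm (axis i 1 :: real ^ 'n) = norm u" by (simp add: norm_u)
    then obtain T where T: "orthogonal_transformation T" "T (axis i 1 :: real ^ 'n) = u"
      by (rule orthogonal_transformation_exists)
    obtain S where S: "orthogonal_transformation S" "\<And>y. T (S y) = y"
      using orthogonal_transformation_inv[OF T(1)] orthogonal_transformation_surj[OF T(1)]
      by (metis surj_f_inv_f)
    \<comment> \<open>\<open>T\<close> preserves inner products, sends the axis vector to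
      \<open>u\<close>, and \<open>y = T (S y)\<close>.\<close>
    have "u \<bullet> y = axis i 1 \<bullet> S y" for y
      using T S(2)[of y] unfolding orthogonal_transformation_def by metis
    then have "t = (\<integral>x. \<bar>axis i 1 \<bullet> S (x - c)\<bar> \<partial>\<pi>)" by (simp add: t_def)
    also have "\<dots> = (\<integral>x. \<bar>axis i 1 \<bullet> (x - c)\<bar> \<partial>\<pi>)"
      by (rule integral_symmetric[OF sym sets_prior S(1)]) simp
    finally have "(\<integral>x. \<bar>axis i 1 \<bullet> (x - c)\<bar> \<partial>\<pi>) = 0" using t0 by simp
    moreover have "integrable \<pi> (\<lambda>x. \<bar>axis i 1 \<bullet> (x - c)\<bar>)"
      by (intro integrable_abs integrable_inner_right Bochner_Integration.integrable_diff
            integrable_prior) simp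
    ultimately have "AE x in \<pi>. \<bar>axis i 1 \<bullet> (x - c)\<bar> = 0"
      by (subst (asm) integral_nonneg_eq_0_iff_AE) auto
    then show ?thesis by (simp add: inner_axis')
  qed
  then have "AE x in \<pi>. \<forall>i\<in>UNIV. x $ i = c $ i" by (intro AE_finite_allI) auto
  then have "AE x in \<pi>. x = c" by (simp add: vec_eq_iff)
  then show False
    using prob_space_eq_return[OF prob_space_axioms sets_prior] not_return by auto
qed

end

section \<open>Strategies with two reports, and Bayes' rule\<close>

locale split_game = split_prior \<pi> c u for \<pi> :: "(real ^ 'n) measure" and c u +
  fixes R :: "'m measure" and p q :: 'm and b :: "real ^ 'n"
  assumes reports: "p \<in> space R" "q \<in> space R" "p \<noteq> q" "{p} \<in> sets R" "{q} \<in> sets R"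
    and orth: "u \<bullet> b = 0"
begin

definition user_split :: "real ^ 'n \<Rightarrow> 'm measure" where
  "user_split x = distr (measure_pmf (bernoulli_pmf ((1 + side x) / 2))) R (\<lambda>a. if a then p else q)"

text \<open>Every report other than \<open>q\<close> is read as \<open>p\<close>, so a deviation to
  an unsent report only reproduces the response to \<open>p\<close>.\<close>

definition sign :: "'m \<Rightarrow> real" where
  "sign m = (if m = q then - 1 else 1)"

definition learner_split :: "'m \<Rightarrow> (real ^ 'n) measure" where
  "learner_split m = return borel (c + (sign m * t) *\<^sub>R u)"

lemma sign_measurable[measurable]: "sign \<in> borel_measurable R"
proof -
  have [measurable]: "{q} \<in> sets R" by (rule reports)
  have "(\<lambda>m. if m \<in> {q} then - 1 else 1 :: real) \<in> borel_measurable R" by measurable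
  then show ?thesis by (simp add: sign_def[abs_def])
qed

lemma sign_simps[simp]: "sign p = 1" "sign q = - 1" "\<bar>sign m\<bar> \<le> 1"
  using reports by (auto simp: sign_def)

lemma side_bounds: "0 \<le> 1 + side x" "0 \<le> 1 - side x" "side x \<le> 1" "- 1 \<le> side x"
  using abs_side_le[of x] by auto

lemma nn_integral_user_split:
  assumes [measurable]: "f \<in> borel_measurable R"
  shows "(\<integral>\<^sup>+m. f m \<partial>user_split x)
    = ennreal ((1 + side x) / 2) * f p + ennreal ((1 - side x) / 2) * f q"
proof -
  have eq: "1 - (1 + side x) / 2 = (1 - side x) / 2" by (simp add: field_simps)
  show ?thesis
    unfolding user_split_def using reports side_bounds[of x]
    by (subst nn_integral_distr)
      (auto simp: nn_integral_measure_pmf nn_integral_count_space_finite UNIV_bool eq mult.commute)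
qed

lemma sets_user_split[measurable_cong]: "sets (user_split x) = sets R"
  by (simp add: user_split_def)

lemma emeasure_user_split:
  assumes "B \<in> sets R"
  shows "emeasure (user_split x) B
    = ennreal ((1 + side x) / 2) * indicator B p + ennreal ((1 - side x) / 2) * indicator B q"
  using nn_integral_user_split[of "indicator B" x] assms by (simp add: sets_user_split)

lemma user_split_measurable[measurable]: "user_split \<in> borel \<rightarrow>\<^sub>M prob_algebra R"
proof (rule measurable_prob_algebraI)
  show ps: "prob_space (user_split x)" for x
    unfolding user_split_def using reports
    by (intro prob_space.prob_space_distr) (auto intro: prob_space_measure_pmf)
  show "user_split \<in> borel \<rightarrow>\<^sub>M subprob_algebra R"
  proof (rule measurable_subprob_algebra)
    show "(\<lambda>x. emeasure (user_split x) B) \<in> borel_measurable borel" if "B \<in> sets R" for B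
      unfolding emeasure_user_split[OF that] by measurable
  qed (auto simp: sets_user_split intro: prob_space_imp_subprob_space ps)
qed

text \<open>Since \<open>side\<close> has mean zero, the coin of the user is fair on average over
  the prior, and the reports \<open>p\<close> and \<open>q\<close> carry mass 1/2 each.\<close>

lemma nn_integral_report_law:
  assumes [measurable]: "f \<in> borel_measurable R"
  shows "(\<integral>\<^sup>+m. f m \<partial>report_law \<pi> user_split) = f p / 2 + f q / 2"
proof -
  have half: "(\<integral>\<^sup>+x. ennreal ((1 + s * side x) / 2) \<partial>\<pi>) = 1 / 2" if "\<bar>s\<bar> \<le> 1" for s
    using nn_integral_divide[of "\<lambda>x. ennreal (1 + s * side x)" \<pi> 2] that
    by (simp add: integral_one_plus_side divide_ennreal[symmetric] one_plus_side_nonneg)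
  have "(\<integral>\<^sup>+m. f m \<partial>report_law \<pi> user_split) = (\<integral>\<^sup>+x. \<integral>\<^sup>+m. f m \<partial>user_split x \<partial>\<pi>)"
    unfolding report_law_def
    by (rule nn_integral_bind[where B = R]) (auto intro!: measurable_prob_algebraD)
  also have "\<dots> = 1 / 2 * f p + 1 / 2 * f q"
    using half[of 1] half[of "- 1"]
    by (simp add: nn_integral_user_split nn_integral_add nn_integral_multc)
  finally show ?thesis by (simp add: ennreal_times_divide divide_ennreal_def mult.commute)
qed

lemma sets_report_law: "sets (report_law \<pi> user_split) = sets R"
  unfolding report_law_def by (rule sets_bind) (auto simp: sets_user_split not_empty)

text \<open>For either sent report, \<open>emeasure (tilt s) A / 2\<close> is the joint probability
  of that report and \<open>A\<close>; the report law charges no other report.\<close>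

lemma bayes_belief_split: "bayes_belief R \<pi> user_split (\<lambda>m. tilt (sign m))"
  unfolding bayes_belief_def
proof (intro conjI ballI)
  have [measurable]: "{q} \<in> sets R" by (rule reports)
  \<comment> \<open>The belief takes only two values, so its measurability reduces to that of the
    singleton \<open>{q}\<close>.\<close>
  have "(\<lambda>m. if m \<in> {q} then tilt (- 1) else tilt 1) \<in> R \<rightarrow>\<^sub>M prob_algebra borel"
    by (rule measurable_If_set) (auto intro!: measurable_const tilt_in_prob_algebra)
  moreover have "tilt (sign m) = (if m \<in> {q} then tilt (- 1) else tilt 1)" for m
    by (simp add: sign_def)
  ultimately show belief[measurable]: "(\<lambda>m. tilt (sign m)) \<in> R \<rightarrow>\<^sub>M prob_algebra borel" by simp
  fix A :: "(real ^ 'n) set" and B assume A[measurable]: "A \<in> sets borel" and B[measurable]: "B \<in> sets R"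
  have tilt: "emeasure (tilt s) A / 2 = (\<integral>\<^sup>+x\<in>A. ennreal ((1 + s * side x) / 2) \<partial>\<pi>)" if "\<bar>s\<bar> \<le> 1" for s
  proof -
    have "emeasure (tilt s) A / 2 = (\<integral>\<^sup>+x. ennreal (1 + s * side x) * indicator A x / 2 \<partial>\<pi>)"
      unfolding tilt_def by (simp add: emeasure_density sets_prior nn_integral_divide)
    also have "\<dots> = (\<integral>\<^sup>+x\<in>A. ennreal ((1 + s * side x) / 2) \<partial>\<pi>)"
      using that
      by (intro nn_integral_cong)
        (simp add: divide_ennreal[symmetric] one_plus_side_nonneg split: split_indicator)
    finally show ?thesis .
  qed
  have [measurable]: "(\<lambda>m. emeasure (tilt (sign m)) A) \<in> borel_measurable R"
    by (rule measurable_compose[OF measurable_prob_algebraD[OF belief]]) simp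
  have "(\<integral>\<^sup>+m\<in>B. emeasure (tilt (sign m)) A \<partial>report_law \<pi> user_split)
      = emeasure (tilt 1) A / 2 * indicator B p + emeasure (tilt (- 1)) A / 2 * indicator B q"
    by (subst nn_integral_report_law) (auto simp: divide_ennreal_def mult_ac)
  also have "\<dots> = (\<integral>\<^sup>+x\<in>A. emeasure (user_split x) B \<partial>\<pi>)"
    by (cases "p \<in> B"; cases "q \<in> B")
      (simp_all add: tilt emeasure_user_split nn_integral_add distrib_right)
  finally show "(\<integral>\<^sup>+x\<in>A. emeasure (user_split x) B \<partial>\<pi>)
      = (\<integral>\<^sup>+m\<in>B. emeasure (tilt (sign m)) A \<partial>report_law \<pi> user_split)" ..
qed

section \<open>Incentives, equilibrium and influence\<close>

text \<open>As \<open>u\<close> is orthogonal to \<open>b\<close>, the bias enters the utility only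
  through a term common to all reports. What depends on the report is
  \<open>2 * t * (sign m' * (u \<bullet> (x - c)))\<close>, largest when the sign agrees with the
  side of \<open>x\<close>.\<close>

lemma user_best_report_split:
  assumes "sign m * side x \<ge> 0"
  shows "user_best_report R b learner_split x m"
proof -
  have uu: "u \<bullet> u = 1" using norm_u by (simp add: norm_eq_1)
  have eq: "expected_utility (learner_split m') (user_utility b x)
      = ereal (- (norm (c - x - b))\<^sup>2 - t\<^sup>2 + 2 * t * (sign m' * (u \<bullet> (x - c))))" for m'
  proof -
    have s: "sign m' * sign m' = 1" by (simp add: sign_def)
    have "(norm (c + (sign m' * t) *\<^sub>R u - (x + b)))\<^sup>2
        = (norm (c - x - b))\<^sup>2 + (sign m' * sign m') * t\<^sup>2 - 2 * t * (sign m' * (u \<bullet> (x - c)))"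
      unfolding power2_norm_eq_inner
      using orth by (simp add: inner_diff inner_add inner_commute uu algebra_simps power2_eq_square)
    then have "- (norm (c + (sign m' * t) *\<^sub>R u - (x + b)))\<^sup>2
        = - (norm (c - x - b))\<^sup>2 - t\<^sup>2 + 2 * t * (sign m' * (u \<bullet> (x - c)))"
      by (simp add: s)
    moreover have "expected_utility (learner_split m') (user_utility b x)
        = ereal (- (norm (c + (sign m' * t) *\<^sub>R u - (x + b)))\<^sup>2)"
      by (simp add: expected_utility_def learner_split_def user_utility_def nn_integral_return
            enn2ereal_ennreal)
    ultimately show ?thesis by simp
  qed
  \<comment> \<open>By assumption the right-hand side is the absolute value of
    \<open>u \<bullet> (x - c)\<close>; on the hyperplane both sides are 0 and the user is
    indifferent.\<close>
  have "sign m' * (u \<bullet> (x - c)) \<le> sign m * (u \<bullet> (x - c))" for m'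
    using assms by (auto simp: sign_def side_def sgn_real_def split: if_splits)
  then show ?thesis
    unfolding user_best_report_def eq using t_pos by simp
qed

lemma equilibrium_split: "equilibrium R \<pi> b user_split learner_split"
  unfolding equilibrium_def
proof (intro conjI allI)
  show "user_strategy R user_split" by (simp add: user_strategy_def)
  show "learner_strategy R learner_split"
    unfolding learner_strategy_def learner_split_def
    by measurable
  show "AE m in user_split x. user_best_report R b learner_split x m" for x
  proof -
    \<comment> \<open>Off the hyperplane the coin is deterministic and gives weight 0 to the report
      naming the wrong side; on it the set is empty.\<close>
    have "emeasure (user_split x) {m \<in> space R. \<not> sign m * side x \<ge> 0} = 0"
      using reports side_bounds[of x]
      by (subst emeasure_user_split)
        (auto simp: indicator_def side_def sgn_real_def not_le split: if_splits)
    then have "AE m in user_split x. sign m * side x \<ge> 0"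
      by (intro AE_I[where N = "{m \<in> space R. \<not> sign m * side x \<ge> 0}"])
        (auto simp: sets_user_split sets_eq_imp_space_eq[OF sets_user_split])
    then show ?thesis by eventually_elim (rule user_best_report_split)
  qed
  show "\<exists>\<Phi>. bayes_belief R \<pi> user_split \<Phi> \<and>
      (\<forall>m\<in>space R. AE w in learner_split m. learner_best_response (\<Phi> m) w)"
  proof (intro exI conjI ballI)
    show "bayes_belief R \<pi> user_split (\<lambda>m. tilt (sign m))" by (rule bayes_belief_split)
    fix m
    have "AE w in learner_split m. w = c + (sign m * t) *\<^sub>R u"
      unfolding learner_split_def by (subst AE_return) auto
    then show "AE w in learner_split m. learner_best_response (tilt (sign m)) w"
      by eventually_elim (simp add: learner_best_response_tilt)
  qed
qed

lemma influential_split: "influential R \<pi> user_split learner_split"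
proof -
  have m: "measure (report_law \<pi> user_split) {m} > 0" if "m = p \<or> m = q" for m
  proof -
    have *: "{m} \<in> sets R" using that reports by auto
    from * have "emeasure (report_law \<pi> user_split) {m} = 1 / 2"
      using nn_integral_report_law[of "indicator {m}"] that reports by (auto simp: sets_report_law)
    also have "\<dots> = ennreal (1 / 2)" using divide_ennreal[of 1 2] by simp
    finally have "measure (report_law \<pi> user_split) {m} = 1 / 2"
      by (intro measure_eq_emeasure_eq_ennreal) auto
    then show ?thesis by simp
  qed
  have "learner_split p \<noteq> learner_split q"
  proof
    assume "learner_split p = learner_split q"
    \<comment> \<open>The singleton of the response to \<open>p\<close> separates the two point
      masses, since \<open>t\<close> is positive.\<close>
    then have "emeasure (learner_split p) {c + t *\<^sub>R u} = emeasure (learner_split q) {c + t *\<^sub>R u}"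
      by simp
    then have "c - t *\<^sub>R u = c + t *\<^sub>R u"
      by (simp add: learner_split_def indicator_def split: if_splits)
    then have "u \<bullet> (c - t *\<^sub>R u) = u \<bullet> (c + t *\<^sub>R u)" by (rule arg_cong)
    then show False
      using t_pos norm_u by (simp add: inner_diff_right inner_add_right norm_eq_1)
  qed
  then show ?thesis using m reports unfolding influential_def by blast
qed

end

section \<open>Choice of the direction and of the two reports\<close>

theorem theorem4p3:
  fixes \<pi> :: "(real ^ 'n) measure" and R :: "'m measure"
  assumes "CARD('n) > 1"
    and "rich_report_space TYPE('n) R"
    and "prob_space \<pi>" and "sets \<pi> = sets borel"
    and "integrable \<pi> (\<lambda>x. norm x)"
    and "\<not> (\<exists>c. \<pi> = return borel c)"
    and "spherically_symmetric_around \<pi> (\<integral>x. x \<partial>\<pi>)"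
  shows "\<forall>b :: real ^ 'n. learning_is_influential R \<pi> b"
proof
  fix b :: "real ^ 'n"
  \<comment> \<open>Dimension greater than 1 enters here: some nonzero vector is orthogonal to
    \<open>b\<close>, also when \<open>b = 0\<close>.\<close>
  obtain v where v: "v \<noteq> 0" "orthogonal b v"
    using orthogonal_to_vector_exists[of b] assms(1) by auto
  define u where "u = v /\<^sub>R norm v"
  have u: "norm u = 1" "u \<bullet> b = 0"
    using v by (auto simp: u_def orthogonal_def inner_commute)
  obtain name :: "(real ^ 'n) set \<Rightarrow> 'm"
    where name: "inj_on name (sets borel)" "name ` sets borel \<subseteq> space R"
      and sing: "\<forall>m\<in>space R. {m} \<in> sets R"
    using assms(2) by (auto simp: rich_report_space_def)
  \<comment> \<open>The two reports serve as mere labels; the names of two different Borel sets are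
    distinct by injectivity.\<close>
  have sp: "name {} \<in> space R" "name UNIV \<in> space R" using name(2) by auto
  have ne: "name {} \<noteq> name UNIV" using inj_onD[OF name(1), of "{}" UNIV] by auto
  interpret split_game \<pi> "\<integral>x. x \<partial>\<pi>" u R "name {}" "name UNIV" b
    unfolding split_game_def split_prior_def split_prior_axioms_def split_game_axioms_def
    using assms u sp ne sing by auto
  show "learning_is_influential R \<pi> b"
    unfolding learning_is_influential_def using equilibrium_split influential_split by blast
qed

end
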